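(* Let $\underline P:\mathcal A(\mathbb P)\to\mathbb R$ be a coherent lower probability with conjugate $\overline P$, and let $B\in\mathcal A(\mathbb P)\setminus\{\emptyset\}$ be such that $\underline P(B)=0<\overline P(B)$. Define $\underline R$ on $\mathcal A(\mathbb P)\cup\mathcal A(\mathbb P)|B$ by $\underline R=\inf_{P\in\mathcal M_B^+}P$ (pointwise infimum). Then: (a) $\underline R:\mathcal A(\mathbb P)\cup\mathcal A(\mathbb P)|B\to\mathbb R$ is a W-coherent lower probability. (b) $\underline R=\underline P$ on $\mathcal A(\mathbb P)$.
   Context: Let $\mathbb P$ be a partition (finite or infinite) of the sure event $\Omega$ and $\mathcal A(\mathbb P)$ the set of events logically dependent on $\mathbb P$, i.e. (identifying events with sets) the power set of $\mathbb P$. For $B\ne\emptyset$, $\mathcal A(\mathbb P)|B=\{A|B:A\in\mathcal A(\mathbb P)\}$. "Probability" on $\mathcal A(\mathbb P)$ means finitely additive probability. A coherent (precise) probability on $\mathcal A(\mathbb P)\cup\mathcal A(\mathbb P)|B$ is a map $P$ whose restriction to $\mathcal A(\mathbb P)$ is a probability, with $P(\cdot|B)$ a probability on $\mathcal A(\mathbb P)$ such that $P(B|B)=1$ and $P(A\wedge B)=P(A|B)P(B)$ for all $A\in\mathcal A(\mathbb P)$. A lower probability on $\mathcal A(\mathbb P)$ (respectively on $\mathcal A(\mathbb P)\cup\mathcal A(\mathbb P)|B$) is coherent, or W-coherent (Williams-coherent), if it is the pointwise infimum of a non-empty set of coherent precise probabilities on that domain (Envelope Theorem characterisation). The conjugate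 is $\overline P(A)=1-\underline P(A^{\mathsf c})$. The credal set is $\mathcal M=\{P\text{ probability on }\mathcal A(\mathbb P):P\ge\underline P\}$. Put $\mathcal M^+=\{P\in\mathcal M:P(B)>0\}$ (non-empty when $\overline P(B)>0$), and let $\mathcal M_B^+$ be the set of coherent probabilities on $\mathcal A(\mathbb P)\cup\mathcal A(\mathbb P)|B$ whose restriction to $\mathcal A(\mathbb P)$ is in $\mathcal M^+$; thus for such $P$, $P(A|B)=P(A\wedge B)/P(B)$. *)

theory Defs
  imports "HOL-Analysis.Analysis"
begin

text \<open>
  Throughout, \<open>\<Omega>\<close> is the sure event, \<open>PP\<close> a partition of it (\<open>partition_on \<Omega> PP\<close>, of any
  cardinality), and an event is a subset of \<open>\<Omega>\<close>.  Lower probabilities and probabilities are total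
  functions of which only the values on the stated domain are ever constrained or used.
\<close>

text \<open>The events logically dependent on \<open>PP\<close> are the disjunctions of elements of \<open>PP\<close>;
  \<open>\<Union>\<close> identifies them with the power set of \<open>PP\<close>.\<close>

definition dep_events :: "'w set set \<Rightarrow> 'w set set" where
  "dep_events PP = {\<Union>S | S. S \<subseteq> PP}"

text \<open>The pair \<open>(A, B)\<close> stands for the conditional event \<open>A|B\<close>; an unconditional event \<open>A\<close> is
  identified, as usual, with \<open>A|\<Omega>\<close>.\<close>

type_synonym 'w cond_event = "'w set \<times> 'w set"

definition cond_events :: "'w set \<Rightarrow> 'w set set \<Rightarrow> 'w set \<Rightarrow> 'w cond_event set" where
  "cond_events \<Omega> PP B = {(A, \<Omega>) | A. A \<in> dep_events PP} \<union> {(A, B) | A. A \<in> dep_events PP}"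

definition fa_prob :: "'w set \<Rightarrow> 'w set set \<Rightarrow> ('w set \<Rightarrow> real) \<Rightarrow> bool" where
  "fa_prob \<Omega> PP P \<longleftrightarrow>
     (\<forall>A\<in>dep_events PP. 0 \<le> P A) \<and> P \<Omega> = 1 \<and> additive (dep_events PP) P"

definition coherent_cond_prob ::
    "'w set \<Rightarrow> 'w set set \<Rightarrow> 'w set \<Rightarrow> ('w cond_event \<Rightarrow> real) \<Rightarrow> bool" where
  "coherent_cond_prob \<Omega> PP B P \<longleftrightarrow>
     fa_prob \<Omega> PP (\<lambda>A. P (A, \<Omega>)) \<and>
     fa_prob \<Omega> PP (\<lambda>A. P (A, B)) \<and>
     P (B, B) = 1 \<and>
     (\<forall>A\<in>dep_events PP. P (A \<inter> B, \<Omega>) = P (A, B) * P (B, \<Omega>))"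

text \<open>The real infimum is only meaningful for non-empty families bounded below; in all uses the
  members of \<open>\<P>\<close> are non-negative on \<open>D\<close>.\<close>

definition is_lower_envelope :: "'e set \<Rightarrow> ('e \<Rightarrow> real) set \<Rightarrow> ('e \<Rightarrow> real) \<Rightarrow> bool" where
  "is_lower_envelope D \<P> f \<longleftrightarrow> \<P> \<noteq> {} \<and> (\<forall>E\<in>D. f E = (INF P\<in>\<P>. P E))"

definition coherent_lower_prob :: "'w set \<Rightarrow> 'w set set \<Rightarrow> ('w set \<Rightarrow> real) \<Rightarrow> bool" where
  "coherent_lower_prob \<Omega> PP lowP \<longleftrightarrow>
     (\<exists>\<P> \<subseteq> {P. fa_prob \<Omega> PP P}. is_lower_envelope (dep_events PP) \<P> lowP)"

definition W_coherent_lower_prob ::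
    "'w set \<Rightarrow> 'w set set \<Rightarrow> 'w set \<Rightarrow> ('w cond_event \<Rightarrow> real) \<Rightarrow> bool" where
  "W_coherent_lower_prob \<Omega> PP B lowR \<longleftrightarrow>
     (\<exists>\<P> \<subseteq> {P. coherent_cond_prob \<Omega> PP B P}. is_lower_envelope (cond_events \<Omega> PP B) \<P> lowR)"

definition conjugate :: "'w set \<Rightarrow> ('w set \<Rightarrow> real) \<Rightarrow> 'w set \<Rightarrow> real" where
  "conjugate \<Omega> lowP A = 1 - lowP (\<Omega> - A)"

definition credal_set :: "'w set \<Rightarrow> 'w set set \<Rightarrow> ('w set \<Rightarrow> real) \<Rightarrow> ('w set \<Rightarrow> real) set" where
  "credal_set \<Omega> PP lowP = {P. fa_prob \<Omega> PP P \<and> (\<forall>A\<in>dep_events PP. P A \<ge> lowP A)}"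

definition credal_set_pos ::
    "'w set \<Rightarrow> 'w set set \<Rightarrow> ('w set \<Rightarrow> real) \<Rightarrow> 'w set \<Rightarrow> ('w set \<Rightarrow> real) set" where
  "credal_set_pos \<Omega> PP lowP B = {P \<in> credal_set \<Omega> PP lowP. P B > 0}"

definition cond_credal_set_pos ::
    "'w set \<Rightarrow> 'w set set \<Rightarrow> ('w set \<Rightarrow> real) \<Rightarrow> 'w set \<Rightarrow> ('w cond_event \<Rightarrow> real) set" where
  "cond_credal_set_pos \<Omega> PP lowP B =
     {P. coherent_cond_prob \<Omega> PP B P \<and> (\<lambda>A. P (A, \<Omega>)) \<in> credal_set_pos \<Omega> PP lowP B}"

definition lower_R ::
    "'w set \<Rightarrow> 'w set set \<Rightarrow> ('w set \<Rightarrow> real) \<Rightarrow> 'w set \<Rightarrow> 'w cond_event \<Rightarrow> real" where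
  "lower_R \<Omega> PP lowP B E = (INF P\<in>cond_credal_set_pos \<Omega> PP lowP B. P E)"

end

theory Submission
  imports Defs
begin

text \<open>
  Some \<open>P0\<close> in the credal set has \<open>P0 B > 0\<close>, because \<open>lowP (\<Omega> - B) < 1\<close>. For any \<open>Q\<close> in the
  credal set the mixture \<open>(1 - t) * Q + t * P0\<close> with \<open>0 < t \<le> 1\<close> stays in the credal set, gives
  positive probability to \<open>B\<close>, hence extends to conditional events by Bayes' rule, and tends to
  \<open>Q\<close> as \<open>t\<close> tends to 0. So requiring \<open>P B > 0\<close> does not change the infimum.
\<close>

lemma dep_events_space: "partition_on \<Omega> PP \<Longrightarrow> \<Omega> \<in> dep_events PP"
  unfolding dep_events_def by (auto dest: partition_onD1)

lemma dep_events_subset: "partition_on \<Omega> PP \<Longrightarrow> A \<in> dep_events PP \<Longrightarrow> A \<subseteq> \<Omega>"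
  unfolding dep_events_def by (auto dest: partition_onD1)

text \<open>Cells sharing a point coincide, so removing \<open>\<Union>T\<close> from
  \<open>\<Union>S\<close> removes exactly the cells in \<open>T\<close>.\<close>

lemma dep_events_Diff:
  assumes "partition_on \<Omega> PP" "A \<in> dep_events PP" "C \<in> dep_events PP"
  shows "A - C \<in> dep_events PP"
proof -
  obtain S T where ST: "A = \<Union>S" "S \<subseteq> PP" "C = \<Union>T" "T \<subseteq> PP"
    using assms(2,3) unfolding dep_events_def by auto
  have "X = Y" if "X \<in> PP" "Y \<in> PP" "x \<in> X" "x \<in> Y" for x X Y
    using that partition_onD2[OF assms(1)] unfolding disjoint_def by blast
  then have "A - C = \<Union>(S - T)"
    using ST by blast
  then show ?thesis
    using ST unfolding dep_events_def by blast
qed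

lemma dep_events_Int:
  assumes "partition_on \<Omega> PP" "A \<in> dep_events PP" "C \<in> dep_events PP"
  shows "A \<inter> C \<in> dep_events PP"
  using dep_events_Diff[OF assms(1,2) dep_events_Diff[OF assms]] by (simp add: Diff_Diff_Int)

lemma fa_prob_nonneg: "fa_prob \<Omega> PP P \<Longrightarrow> A \<in> dep_events PP \<Longrightarrow> 0 \<le> P A"
  by (simp add: fa_prob_def)

lemma fa_prob_space: "fa_prob \<Omega> PP P \<Longrightarrow> P \<Omega> = 1"
  by (simp add: fa_prob_def)

lemma fa_prob_Un:
  "fa_prob \<Omega> PP P \<Longrightarrow> A \<in> dep_events PP \<Longrightarrow> C \<in> dep_events PP \<Longrightarrow> A \<inter> C = {} \<Longrightarrow>
    P (A \<union> C) = P A + P C"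
  by (simp add: fa_prob_def additive_def)

lemma fa_prob_Compl:
  assumes "partition_on \<Omega> PP" "fa_prob \<Omega> PP P" "A \<in> dep_events PP"
  shows "P (\<Omega> - A) = 1 - P A"
proof -
  have "A \<union> (\<Omega> - A) = \<Omega>"
    using dep_events_subset[OF assms(1,3)] by blast
  then show ?thesis
    using fa_prob_Un[OF assms(2,3) dep_events_Diff[OF assms(1) dep_events_space[OF assms(1)] assms(3)]]
      fa_prob_space[OF assms(2)] by simp
qed

lemma fa_prob_le_1:
  assumes "partition_on \<Omega> PP" "fa_prob \<Omega> PP P" "A \<in> dep_events PP"
  shows "P A \<le> 1"
  using fa_prob_Compl[OF assms]
    fa_prob_nonneg[OF assms(2) dep_events_Diff[OF assms(1) dep_events_space[OF assms(1)] assms(3)]]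
  by simp

lemma fa_prob_mix:
  assumes "fa_prob \<Omega> PP P" "fa_prob \<Omega> PP Q" "0 \<le> t" "t \<le> 1"
  shows "fa_prob \<Omega> PP (\<lambda>A. (1 - t) * P A + t * Q A)"
proof -
  have "0 \<le> (1 - t) * P A + t * Q A" if "A \<in> dep_events PP" for A
    using assms fa_prob_nonneg[OF _ that] by (intro add_nonneg_nonneg mult_nonneg_nonneg) auto
  then show ?thesis
    using assms unfolding fa_prob_def additive_def by (simp add: algebra_simps)
qed

text \<open>Convexity of the credal set: \<open>lowP A\<close> is its own mixture, so the two
  domination inequalities can be averaged.\<close>

lemma credal_set_mix:
  assumes "P \<in> credal_set \<Omega> PP lowP" "Q \<in> credal_set \<Omega> PP lowP" "0 \<le> t" "t \<le> 1"
  shows "(\<lambda>A. (1 - t) * P A + t * Q A) \<in> credal_set \<Omega> PP lowP"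
proof -
  have "(1 - t) * P A + t * Q A \<ge> lowP A" if "A \<in> dep_events PP" for A
  proof -
    have "lowP A = (1 - t) * lowP A + t * lowP A"
      by (simp add: algebra_simps)
    also have "\<dots> \<le> (1 - t) * P A + t * Q A"
      using assms that unfolding credal_set_def by (intro add_mono mult_left_mono) auto
    finally show ?thesis .
  qed
  then show ?thesis
    using assms unfolding credal_set_def by (auto intro: fa_prob_mix)
qed

text \<open>Members of the enveloping family come arbitrarily close to the infimum at
  \<open>A\<close>, and each dominates \<open>lowP\<close> on all events, hence lies in the credal
  set.\<close>

lemma coherent_lower_prob_approx:
  assumes "coherent_lower_prob \<Omega> PP lowP" "A \<in> dep_events PP" "lowP A < u"
  obtains P where "P \<in> credal_set \<Omega> PP lowP" "P A < u"
proof -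
  obtain \<P> where \<P>: "\<P> \<subseteq> {P. fa_prob \<Omega> PP P}" "\<P> \<noteq> {}"
      "\<And>C. C \<in> dep_events PP \<Longrightarrow> lowP C = (INF P\<in>\<P>. P C)"
    using assms(1) unfolding coherent_lower_prob_def is_lower_envelope_def by blast
  have bdd: "bdd_below ((\<lambda>P. P C) ` \<P>)" if "C \<in> dep_events PP" for C
    using \<P>(1) fa_prob_nonneg that by (intro bdd_belowI2[where m = 0]) blast
  obtain P where P: "P \<in> \<P>" "P A < u"
    using cInf_lessD[of "(\<lambda>P. P A) ` \<P>" u] \<P>(2) \<P>(3)[OF assms(2)] assms(3) by auto
  have "P \<in> credal_set \<Omega> PP lowP"
    using P(1) \<P>(1,3) cINF_lower[OF bdd] unfolding credal_set_def by auto
  then show ?thesis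
    using P(2) that by blast
qed

lemma coherent_cond_prob_Bayes:
  assumes "partition_on \<Omega> PP" "fa_prob \<Omega> PP P" "B \<in> dep_events PP" "0 < P B"
  shows "coherent_cond_prob \<Omega> PP B (\<lambda>(A, C). P (A \<inter> C) / P C)"
proof -
  \<comment> \<open>Stated for general \<open>C\<close> to serve both \<open>C = B\<close> and
    \<open>C = \<Omega>\<close>: since \<open>P \<Omega> = 1\<close>, the same quotient also yields
    the unconditional probabilities.\<close>
  have cond: "fa_prob \<Omega> PP (\<lambda>A. P (A \<inter> C) / P C)"
    if C: "C \<in> dep_events PP" "0 < P C" for C
  proof -
    have "P ((A \<union> A') \<inter> C) / P C = P (A \<inter> C) / P C + P (A' \<inter> C) / P C"
      if "A \<in> dep_events PP" "A' \<in> dep_events PP" "A \<inter> A' = {}" for A A'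
    proof -
      have "(A \<inter> C) \<inter> (A' \<inter> C) = {}"
        using that(3) by blast
      with fa_prob_Un[OF assms(2) dep_events_Int[OF assms(1) that(1) C(1)]
          dep_events_Int[OF assms(1) that(2) C(1)]]
      show ?thesis
        by (simp add: Int_Un_distrib2 add_divide_distrib)
    qed
    moreover have "\<Omega> \<inter> C = C"
      using dep_events_subset[OF assms(1) C(1)] by blast
    ultimately show ?thesis
      using C fa_prob_nonneg[OF assms(2) dep_events_Int[OF assms(1) _ C(1)]]
      unfolding fa_prob_def additive_def by simp
  qed
  have "A \<inter> B \<inter> \<Omega> = A \<inter> B" "B \<inter> \<Omega> = B" for A
    using dep_events_subset[OF assms(1,3)] by auto
  then show ?thesis
    using cond[OF assms(3,4)] cond[OF dep_events_space[OF assms(1)]] assms(4)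
      fa_prob_space[OF assms(2)]
    unfolding coherent_cond_prob_def by simp
qed

text \<open>Lifts an unconditional probability to the conditional domain by Bayes' rule, so that
  \<open>lower_R\<close> can be bounded above at \<open>(A, \<Omega>)\<close> by constructing
  unconditional probabilities only.\<close>

lemma cond_credal_set_pos_extend:
  assumes "partition_on \<Omega> PP" "B \<in> dep_events PP" "P \<in> credal_set_pos \<Omega> PP lowP B"
  obtains R where "R \<in> cond_credal_set_pos \<Omega> PP lowP B"
    "\<And>A. A \<in> dep_events PP \<Longrightarrow> R (A, \<Omega>) = P A"
proof -
  define R where "R = (\<lambda>(A, C). P (A \<inter> C) / P C)"
  have P: "fa_prob \<Omega> PP P" "0 < P B" "\<And>A. A \<in> dep_events PP \<Longrightarrow> lowP A \<le> P A"
    using assms(3) unfolding credal_set_pos_def credal_set_def by auto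
  have eq: "R (A, \<Omega>) = P A" if "A \<in> dep_events PP" for A
    using fa_prob_space[OF P(1)] dep_events_subset[OF assms(1) that]
    by (simp add: R_def Int_absorb2)
  have coh: "coherent_cond_prob \<Omega> PP B R"
    unfolding R_def by (rule coherent_cond_prob_Bayes[OF assms(1) P(1) assms(2) P(2)])
  then have "(\<lambda>A. R (A, \<Omega>)) \<in> credal_set_pos \<Omega> PP lowP B"
    using P eq assms(2)
    unfolding credal_set_pos_def credal_set_def coherent_cond_prob_def by simp
  with coh have "R \<in> cond_credal_set_pos \<Omega> PP lowP B"
    unfolding cond_credal_set_pos_def by simp
  then show ?thesis
    using eq that by blast
qed

theorem proposition7p1:
  fixes \<Omega> :: "'w set" and PP :: "'w set set" and lowP :: "'w set \<Rightarrow> real" and B :: "'w set"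
  assumes "partition_on \<Omega> PP"
    and "coherent_lower_prob \<Omega> PP lowP"
    and "B \<in> dep_events PP - {{}}"
    and "lowP B = 0"
    and "0 < conjugate \<Omega> lowP B"
  shows "W_coherent_lower_prob \<Omega> PP B (lower_R \<Omega> PP lowP B) \<and>
         (\<forall>A\<in>dep_events PP. lower_R \<Omega> PP lowP B (A, \<Omega>) = lowP A)"
proof -
  let ?M = "cond_credal_set_pos \<Omega> PP lowP B"
  have B: "B \<in> dep_events PP"
    using assms(3) by simp
  \<comment> \<open>The conjugate being positive at \<open>B\<close> means
    \<open>lowP (\<Omega> - B) < 1\<close>.\<close>
  obtain P0 where P0: "P0 \<in> credal_set \<Omega> PP lowP" "P0 (\<Omega> - B) < 1"
    using coherent_lower_prob_approx[OF assms(2)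
        dep_events_Diff[OF assms(1) dep_events_space[OF assms(1)] B], of 1] assms(5)
    unfolding conjugate_def by auto
  have fa: "fa_prob \<Omega> PP P" if "P \<in> credal_set \<Omega> PP lowP" for P
    using that unfolding credal_set_def by simp
  have P0B: "0 < P0 B"
    using P0(2) fa_prob_Compl[OF assms(1) fa[OF P0(1)] B] by simp
  \<comment> \<open>Non-emptiness of \<open>?M\<close>, on which both the infimum and W-coherence
    depend.\<close>
  then obtain R0 where R0: "R0 \<in> ?M"
    using cond_credal_set_pos_extend[OF assms(1) B] P0(1) unfolding credal_set_pos_def by blast
  have "lower_R \<Omega> PP lowP B (A, \<Omega>) = lowP A" if A: "A \<in> dep_events PP" for A
  proof (rule antisym)
    \<comment> \<open>Used twice: it bounds the infimum from below, and it supplies the boundedness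
      required by \<open>cINF_lower\<close>.\<close>
    have lb: "lowP A \<le> R (A, \<Omega>)" if "R \<in> ?M" for R
      using that A unfolding cond_credal_set_pos_def credal_set_pos_def credal_set_def by blast
    then show "lowP A \<le> lower_R \<Omega> PP lowP B (A, \<Omega>)"
      unfolding lower_R_def using R0 by (intro cINF_greatest) auto
    show "lower_R \<Omega> PP lowP B (A, \<Omega>) \<le> lowP A"
    proof (rule field_le_epsilon)
      fix e :: real assume e: "0 < e"
      obtain Q where Q: "Q \<in> credal_set \<Omega> PP lowP" "Q A < lowP A + e / 2"
        using coherent_lower_prob_approx[OF assms(2) A, of "lowP A + e / 2"] e by auto
      \<comment> \<open>The error budget \<open>e\<close> is split in halves: \<open>Q\<close>
        exceeds \<open>lowP A\<close> by less than \<open>e / 2\<close>, and \<open>P0\<close> adds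
        at most \<open>t \<le> e / 2\<close>. The cap at 1 keeps the mixture convex.\<close>
      define t where "t = min 1 (e / 2)"
      have t: "0 < t" "t \<le> 1" "t \<le> e / 2"
        using e by (auto simp: t_def)
      define m where "m = (\<lambda>C. (1 - t) * Q C + t * P0 C)"
      \<comment> \<open>\<open>Q B\<close> may vanish; positivity comes from the term
        \<open>t * P0 B\<close>.\<close>
      have "0 < m B"
        unfolding m_def using t P0B fa_prob_nonneg[OF fa[OF Q(1)] B]
        by (intro add_nonneg_pos) auto
      then have "m \<in> credal_set_pos \<Omega> PP lowP B"
        using credal_set_mix[OF Q(1) P0(1), of t] t unfolding credal_set_pos_def m_def by auto
      then obtain R where R: "R \<in> ?M" "R (A, \<Omega>) = m A"
        using cond_credal_set_pos_extend[OF assms(1) B] A by metis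
      have "lower_R \<Omega> PP lowP B (A, \<Omega>) \<le> R (A, \<Omega>)"
        unfolding lower_R_def using R(1) lb by (intro cINF_lower bdd_belowI2) auto
      also have "\<dots> = (1 - t) * Q A + t * P0 A"
        by (simp add: R(2) m_def)
      also have "\<dots> \<le> 1 * Q A + t * 1"
        using t fa_prob_nonneg[OF fa[OF Q(1)] A] fa_prob_le_1[OF assms(1) fa[OF P0(1)] A]
        by (intro add_mono mult_right_mono mult_left_mono) auto
      also have "\<dots> \<le> lowP A + e"
        using Q(2) t by simp
      finally show "lower_R \<Omega> PP lowP B (A, \<Omega>) \<le> lowP A + e" .
    qed
  qed
  \<comment> \<open>The family defining \<open>lower_R\<close> is itself the required envelope: its
    members are coherent by definition.\<close>
  moreover have "W_coherent_lower_prob \<Omega> PP B (lower_R \<Omega> PP lowP B)"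
    unfolding W_coherent_lower_prob_def is_lower_envelope_def
    using R0 by (intro exI[of _ ?M]) (auto simp: cond_credal_set_pos_def lower_R_def)
  ultimately show ?thesis
    by blast
qed

end
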